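(* Let $\lambda\in\Sigma^+$ be a restricted root, and suppose that $\lambda_I\neq0$. Let $\xi_\lambda\in\mathfrak m_\lambda$ and $\xi'_{\lambda_I}=I\xi_\lambda\in\mathfrak m_{\lambda_I}$, and let $\zeta_\lambda\in\mathfrak k_\lambda$ and $\zeta'_{\lambda_I}\in\mathfrak k_{\lambda_I}$ be the vectors associated with $\xi_\lambda$ and $\xi'_{\lambda_I}$ respectively, i.e. the unique vectors such that for all $w\in\mathfrak a$ $$[w,\xi_\lambda]=i\lambda(w)\zeta_\lambda,\quad[w,\zeta_\lambda]=-i\lambda(w)\xi_\lambda,\qquad [w,\xi'_{\lambda_I}]=i\lambda_I(w)\zeta'_{\lambda_I},\quad[w,\zeta'_{\lambda_I}]=-i\lambda_I(w)\xi'_{\lambda_I}.$$ Then for any $T\in\mathfrak t'$, $$\operatorname{ad}_T(\zeta_\lambda)=i\rho_{\mathfrak k}(\lambda)(T)\,\zeta'_{\lambda_I}.$$ If $\lambda_I=0$, then $[\mathfrak t',\mathfrak k_\lambda]=0$.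
   Context: $G/K$ is an irreducible Hermitian symmetric space of compact type: $\mathfrak g=\mathrm{Lie}(G)$ is a simple compact Lie algebra, $K$ is connected, $\mathfrak g=\mathfrak k\oplus\mathfrak m$ with $[\mathfrak k,\mathfrak m]\subset\mathfrak m$, $[\mathfrak m,\mathfrak m]\subset\mathfrak k$. The one-dimensional center of $\mathfrak k$ contains $Z_0$ such that $I=\operatorname{ad}_{Z_0}|_{\mathfrak m}$ satisfies $I^2=-\mathrm{Id}_{\mathfrak m}$; $[I\xi,I\eta]=[\xi,\eta]$ and $I[\zeta,\eta]=[\zeta,I\eta]$ for $\xi,\eta\in\mathfrak m$, $\zeta\in\mathfrak k$. $\mathfrak a\subset\mathfrak m$ is a maximal abelian subspace, $r=\dim\mathfrak a$, with a fixed basis $X_1,\dots,X_r$ such that, with $Y_j=IX_j$ and $T_j=[X_j,Y_j]$: $[X_j,Y_k]=\delta_j^kT_j$, $[T_j,X_k]=\delta_j^kY_j$, $[T_j,Y_k]=-\delta_j^kX_j$. $\{\epsilon_j\}$ is the dual basis of $(\mathfrak a^{\mathbb C})^*$. $\Sigma$ is the set of restricted roots of $(\mathfrak g^{\mathbb C},\mathfrak a^{\mathbb C})$, $\Sigma^+$ the positive ones for the lexicographic order with respect to the basis $\{-iX_j\}$ of $i\mathfrak a$. $\mathfrak m_\lambda$ and $\mathfrak k_\lambda$ are the sets of $\eta$ in $\mathfrak m$, resp. $\mathfrak k$, with $\operatorname{ad}_w^2\eta=\lambda^2(w)\eta$ for all $w\in\mathfrak a$ (so $\mathfrak m_0=\mathfrak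 a$). It is known that $\Sigma^+\subset(BC)_r^+:=\{\frac i2\epsilon_j,i\epsilon_j\ (1\le j\le r);\ \frac i2(\epsilon_p\pm\epsilon_k)\ (1\le p<k\le r)\}$ and that for $\lambda\in\Sigma^+$ one has $I\mathfrak m_\lambda\subset\mathfrak m_{\lambda_I}$ where $\lambda_I=\frac i2\epsilon_j$ if $\lambda=\frac i2\epsilon_j$, $\lambda_I=0$ if $\lambda=i\epsilon_j$, and $\lambda_I=\frac i2(\epsilon_p\mp\epsilon_k)\in\Sigma^+$ if $\lambda=\frac i2(\epsilon_p\pm\epsilon_k)$; this defines $\lambda_I$. For every $\xi_\lambda\in\mathfrak m_\lambda$, $\lambda\in\Sigma^+$, the vector $\zeta_\lambda\in\mathfrak k_\lambda$ with the displayed property exists and is unique. $\mathfrak t'$ is the span of $T_1,\dots,T_r$, $\{\epsilon'_j\}$ is the basis of $(\mathfrak t'^{\mathbb C})^*$ dual to $\{T_j\}$, and $\rho_{\mathfrak k}:(BC)_r^+\to(\mathfrak t'^{\mathbb C})^*$ is defined by $\frac i2\epsilon_j\mapsto\frac i2\epsilon'_j$, $i\epsilon_j\mapsto0$, $\frac i2(\epsilon_p\pm\epsilon_k)\mapsto\frac i2(\epsilon'_p-\epsilon'_k)$ for $p<k$. *)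

theory Defs
  imports "HOL-Analysis.Analysis"
begin

section \<open>Compact simple Lie algebras and Hermitian symmetric pairs\<close>

text \<open>
  A real Lie algebra lives on a whole type of class \<^class>\<open>euclidean_space\<close>. This class
  only serves to say that the underlying real vector space is finite-dimensional; its inner
  product plays no role except for computing the trace in the Killing form.
\<close>

locale lie_algebra =
  fixes bracket :: "'g::euclidean_space \<Rightarrow> 'g \<Rightarrow> 'g"
  assumes bilinear_bracket: "bilinear bracket"
    and bracket_self: "bracket x x = 0"
    and jacobi: "bracket x (bracket y z) + bracket y (bracket z x) + bracket z (bracket x y) = 0"

definition lie_ideal :: "('g::euclidean_space \<Rightarrow> 'g \<Rightarrow> 'g) \<Rightarrow> 'g set \<Rightarrow> bool" where
  "lie_ideal bracket J \<longleftrightarrow> subspace J \<and> (\<forall>x. \<forall>y\<in>J. bracket x y \<in> J)"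

definition killing_form :: "('g::euclidean_space \<Rightarrow> 'g \<Rightarrow> 'g) \<Rightarrow> 'g \<Rightarrow> 'g \<Rightarrow> real" where
  "killing_form bracket x y = (\<Sum>b\<in>Basis. bracket x (bracket y b) \<bullet> b)"

definition abelian_on :: "('g::euclidean_space \<Rightarrow> 'g \<Rightarrow> 'g) \<Rightarrow> 'g set \<Rightarrow> bool" where
  "abelian_on bracket S \<longleftrightarrow> (\<forall>x\<in>S. \<forall>y\<in>S. bracket x y = 0)"

definition lie_center :: "('g::euclidean_space \<Rightarrow> 'g \<Rightarrow> 'g) \<Rightarrow> 'g set \<Rightarrow> 'g set" where
  "lie_center bracket S = {z \<in> S. \<forall>x\<in>S. bracket z x = 0}"

text \<open>
  A simple Lie algebra is the Lie algebra of a compact group if and only if its Killing form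
  is negative definite.
\<close>

locale compact_simple_lie_algebra = lie_algebra bracket
  for bracket :: "'g::euclidean_space \<Rightarrow> 'g \<Rightarrow> 'g" +
  assumes not_abelian: "\<not> abelian_on bracket UNIV"
    and no_proper_ideal: "lie_ideal bracket J \<Longrightarrow> J = {0} \<or> J = UNIV"
    and killing_negative_definite: "x \<noteq> 0 \<Longrightarrow> killing_form bracket x x < 0"

text \<open>
  The infinitesimal data of an irreducible Hermitian symmetric space \<open>G/K\<close> of compact type.
  The complex structure on \<open>m\<close> is \<open>I \<xi> = [Z0, \<xi>]\<close>.
\<close>

locale hermitian_symmetric_pair = compact_simple_lie_algebra bracket
  for bracket :: "'g::euclidean_space \<Rightarrow> 'g \<Rightarrow> 'g" +
  fixes k m :: "'g set" and Z0 :: 'g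
  assumes subspace_k: "subspace k" and subspace_m: "subspace m"
    and k_inter_m: "k \<inter> m = {0}" and k_plus_m: "{u + v |u v. u \<in> k \<and> v \<in> m} = UNIV"
    and bracket_k_k: "\<lbrakk>x \<in> k; y \<in> k\<rbrakk> \<Longrightarrow> bracket x y \<in> k"
    and bracket_k_m: "\<lbrakk>x \<in> k; y \<in> m\<rbrakk> \<Longrightarrow> bracket x y \<in> m"
    and bracket_m_m: "\<lbrakk>x \<in> m; y \<in> m\<rbrakk> \<Longrightarrow> bracket x y \<in> k"
    and dim_center: "dim (lie_center bracket k) = 1"
    and Z0_center: "Z0 \<in> lie_center bracket k"
    and complex_structure: "\<xi> \<in> m \<Longrightarrow> bracket Z0 (bracket Z0 \<xi>) = - \<xi>"

definition maximal_abelian_in ::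
  "('g::euclidean_space \<Rightarrow> 'g \<Rightarrow> 'g) \<Rightarrow> 'g set \<Rightarrow> 'g set \<Rightarrow> bool" where
  "maximal_abelian_in bracket m a \<longleftrightarrow> subspace a \<and> a \<subseteq> m \<and> abelian_on bracket a \<and>
     (\<forall>b. subspace b \<and> b \<subseteq> m \<and> abelian_on bracket b \<and> a \<subseteq> b \<longrightarrow> b = a)"

text \<open>The vectors \<open>T\<^sub>j = [X\<^sub>j, Y\<^sub>j]\<close> with \<open>Y\<^sub>j = I X\<^sub>j\<close>.\<close>

definition T_vec ::
  "('g::euclidean_space \<Rightarrow> 'g \<Rightarrow> 'g) \<Rightarrow> 'g \<Rightarrow> (nat \<Rightarrow> 'g) \<Rightarrow> nat \<Rightarrow> 'g" where
  "T_vec bracket Z0 X j = bracket (X j) (bracket Z0 (X j))"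

definition T_span ::
  "('g::euclidean_space \<Rightarrow> 'g \<Rightarrow> 'g) \<Rightarrow> 'g \<Rightarrow> nat \<Rightarrow> (nat \<Rightarrow> 'g) \<Rightarrow> 'g set" where
  "T_span bracket Z0 r X = span (T_vec bracket Z0 X ` {1..r})"

locale hermitian_symmetric_pair_with_frame = hermitian_symmetric_pair bracket k m Z0
  for bracket :: "'g::euclidean_space \<Rightarrow> 'g \<Rightarrow> 'g" and k m Z0 +
  fixes a :: "'g set" and r :: nat and X :: "nat \<Rightarrow> 'g"
  assumes maximal_abelian: "maximal_abelian_in bracket m a"
    and inj_X: "inj_on X {1..r}" and independent_X: "independent (X ` {1..r})"
    and span_X: "span (X ` {1..r}) = a"
    and bracket_X_Y: "\<lbrakk>j \<in> {1..r}; l \<in> {1..r}\<rbrakk> \<Longrightarrow>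
      bracket (X j) (bracket Z0 (X l)) = (if j = l then T_vec bracket Z0 X j else 0)"
    and bracket_T_X: "\<lbrakk>j \<in> {1..r}; l \<in> {1..r}\<rbrakk> \<Longrightarrow>
      bracket (T_vec bracket Z0 X j) (X l) = (if j = l then bracket Z0 (X j) else 0)"
    and bracket_T_Y: "\<lbrakk>j \<in> {1..r}; l \<in> {1..r}\<rbrakk> \<Longrightarrow>
      bracket (T_vec bracket Z0 X j) (bracket Z0 (X l)) = (if j = l then - X j else 0)"

section \<open>Complexification and restricted roots\<close>

text \<open>
  A pair \<open>(x, y)\<close> stands for the element \<open>x + \<i> y\<close> of the complexification. For a real
  subspace \<open>V\<close>, the set \<open>V \<times> V\<close> is its complexification.
\<close>

type_synonym 'g cplx = "'g \<times> 'g"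

definition of_re :: "'g::euclidean_space \<Rightarrow> 'g cplx" where
  "of_re x = (x, 0)"

definition cscale :: "complex \<Rightarrow> 'g::euclidean_space cplx \<Rightarrow> 'g cplx" (infixr \<open>*\<^sub>c\<close> 75) where
  "c *\<^sub>c v = (Re c *\<^sub>R fst v - Im c *\<^sub>R snd v, Re c *\<^sub>R snd v + Im c *\<^sub>R fst v)"

definition cbracket ::
  "('g::euclidean_space \<Rightarrow> 'g \<Rightarrow> 'g) \<Rightarrow> 'g cplx \<Rightarrow> 'g cplx \<Rightarrow> 'g cplx" where
  "cbracket bracket v w =
     (bracket (fst v) (fst w) - bracket (snd v) (snd w),
      bracket (fst v) (snd w) + bracket (snd v) (fst w))"

text \<open>
  The complex dual of the complexification of \<open>V\<close>. Functionals are extended by zero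
  outside \<open>V \<times> V\<close>, so that equality of functionals is equality of functions.
\<close>

definition cdual :: "'g::euclidean_space set \<Rightarrow> ('g cplx \<Rightarrow> complex) set" where
  "cdual V = {\<phi>. (\<forall>u \<in> V \<times> V. \<forall>v \<in> V \<times> V. \<phi> (u + v) = \<phi> u + \<phi> v) \<and>
                 (\<forall>c. \<forall>u \<in> V \<times> V. \<phi> (c *\<^sub>c u) = c * \<phi> u) \<and>
                 (\<forall>u. u \<notin> V \<times> V \<longrightarrow> \<phi> u = 0)}"

text \<open>
  The element dual to \<open>B j\<close> of the basis \<open>B 1, \<dots>, B r\<close> of \<open>V = span (B ` {1..r})\<close>, extended
  complex linearly to \<open>V \<times> V\<close>.
\<close>

definition dual_vec :: "nat \<Rightarrow> (nat \<Rightarrow> 'g::euclidean_space) \<Rightarrow> nat \<Rightarrow> 'g cplx \<Rightarrow> complex" where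
  "dual_vec r B j v =
     (if v \<in> span (B ` {1..r}) \<times> span (B ` {1..r})
      then Complex (representation (B ` {1..r}) (fst v) (B j))
                   (representation (B ` {1..r}) (snd v) (B j))
      else 0)"

definition restricted_roots ::
  "('g::euclidean_space \<Rightarrow> 'g \<Rightarrow> 'g) \<Rightarrow> 'g set \<Rightarrow> ('g cplx \<Rightarrow> complex) set" where
  "restricted_roots bracket a =
     {lam \<in> cdual a. lam \<noteq> (\<lambda>_. 0) \<and>
        (\<exists>v. v \<noteq> 0 \<and> (\<forall>w \<in> a \<times> a. cbracket bracket w v = lam w *\<^sub>c v))}"

text \<open>
  Positivity for the lexicographic order with respect to the basis \<open>- \<i> X\<^sub>j\<close> of \<open>\<i> a\<close>.
  Restricted roots take real values on \<open>\<i> a\<close>, so the real part discards nothing.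
\<close>

definition lex_positive ::
  "nat \<Rightarrow> (nat \<Rightarrow> 'g::euclidean_space) \<Rightarrow> ('g cplx \<Rightarrow> complex) \<Rightarrow> bool" where
  "lex_positive r X lam \<longleftrightarrow>
     (\<exists>j\<in>{1..r}. (\<forall>l\<in>{1..<j}. lam ((- \<i>) *\<^sub>c of_re (X l)) = 0) \<and>
        Re (lam ((- \<i>) *\<^sub>c of_re (X j))) > 0)"

definition positive_restricted_roots ::
  "('g::euclidean_space \<Rightarrow> 'g \<Rightarrow> 'g) \<Rightarrow> 'g set \<Rightarrow> nat \<Rightarrow> (nat \<Rightarrow> 'g) \<Rightarrow>
   ('g cplx \<Rightarrow> complex) set" where
  "positive_restricted_roots bracket a r X = {lam \<in> restricted_roots bracket a. lex_positive r X lam}"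

text \<open>The spaces \<open>m\<^sub>\<lambda>\<close> (for \<open>V = m\<close>) and \<open>k\<^sub>\<lambda>\<close> (for \<open>V = k\<close>).\<close>

definition root_space ::
  "('g::euclidean_space \<Rightarrow> 'g \<Rightarrow> 'g) \<Rightarrow> 'g set \<Rightarrow> 'g set \<Rightarrow> ('g cplx \<Rightarrow> complex) \<Rightarrow> 'g set" where
  "root_space bracket a V lam =
     {\<eta> \<in> V. \<forall>w\<in>a. of_re (bracket w (bracket w \<eta>)) = (lam (of_re w))\<^sup>2 *\<^sub>c of_re \<eta>}"

definition associated ::
  "('g::euclidean_space \<Rightarrow> 'g \<Rightarrow> 'g) \<Rightarrow> 'g set \<Rightarrow> 'g set \<Rightarrow> ('g cplx \<Rightarrow> complex) \<Rightarrow> 'g \<Rightarrow> 'g \<Rightarrow> bool"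
  where
  "associated bracket a k lam \<xi> \<zeta> \<longleftrightarrow> \<zeta> \<in> root_space bracket a k lam \<and>
     (\<forall>w\<in>a. of_re (bracket w \<xi>) = (\<i> * lam (of_re w)) *\<^sub>c of_re \<zeta> \<and>
            of_re (bracket w \<zeta>) = (- \<i> * lam (of_re w)) *\<^sub>c of_re \<xi>)"

text \<open>
  The following two maps are defined by cases on the set \<open>(BC)\<^sub>r\<^sup>+\<close> of functionals
  \<open>\<i>/2 \<epsilon>\<^sub>j\<close>, \<open>\<i> \<epsilon>\<^sub>j\<close>, \<open>\<i>/2 (\<epsilon>\<^sub>p + \<epsilon>\<^sub>q)\<close>, \<open>\<i>/2 (\<epsilon>\<^sub>p - \<epsilon>\<^sub>q)\<close> with \<open>p < q\<close>, which contains all positive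
  restricted roots; they are unspecified elsewhere. These functionals are pairwise distinct, so
  exactly one disjunct applies to each of them.
\<close>

definition root_I ::
  "nat \<Rightarrow> (nat \<Rightarrow> 'g::euclidean_space) \<Rightarrow> ('g cplx \<Rightarrow> complex) \<Rightarrow> 'g cplx \<Rightarrow> complex" where
  "root_I r X lam = (let \<epsilon> = dual_vec r X in THE \<mu>.
     (\<exists>j\<in>{1..r}. lam = (\<lambda>w. \<i> / 2 * \<epsilon> j w) \<and> \<mu> = (\<lambda>w. \<i> / 2 * \<epsilon> j w)) \<or>
     (\<exists>j\<in>{1..r}. lam = (\<lambda>w. \<i> * \<epsilon> j w) \<and> \<mu> = (\<lambda>_. 0)) \<or>
     (\<exists>p\<in>{1..r}. \<exists>q\<in>{1..r}. p < q \<and>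
        lam = (\<lambda>w. \<i> / 2 * (\<epsilon> p w + \<epsilon> q w)) \<and> \<mu> = (\<lambda>w. \<i> / 2 * (\<epsilon> p w - \<epsilon> q w))) \<or>
     (\<exists>p\<in>{1..r}. \<exists>q\<in>{1..r}. p < q \<and>
        lam = (\<lambda>w. \<i> / 2 * (\<epsilon> p w - \<epsilon> q w)) \<and> \<mu> = (\<lambda>w. \<i> / 2 * (\<epsilon> p w + \<epsilon> q w))))"

definition rho_k ::
  "nat \<Rightarrow> (nat \<Rightarrow> 'g::euclidean_space) \<Rightarrow> (nat \<Rightarrow> 'g) \<Rightarrow> ('g cplx \<Rightarrow> complex) \<Rightarrow>
   'g cplx \<Rightarrow> complex" where
  "rho_k r X T lam = (let \<epsilon> = dual_vec r X; \<epsilon>' = dual_vec r T in THE \<mu>.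
     (\<exists>j\<in>{1..r}. lam = (\<lambda>w. \<i> / 2 * \<epsilon> j w) \<and> \<mu> = (\<lambda>w. \<i> / 2 * \<epsilon>' j w)) \<or>
     (\<exists>j\<in>{1..r}. lam = (\<lambda>w. \<i> * \<epsilon> j w) \<and> \<mu> = (\<lambda>_. 0)) \<or>
     (\<exists>p\<in>{1..r}. \<exists>q\<in>{1..r}. p < q \<and>
        (lam = (\<lambda>w. \<i> / 2 * (\<epsilon> p w + \<epsilon> q w)) \<or> lam = (\<lambda>w. \<i> / 2 * (\<epsilon> p w - \<epsilon> q w))) \<and>
        \<mu> = (\<lambda>w. \<i> / 2 * (\<epsilon>' p w - \<epsilon>' q w))))"

end

theory Submission
  imports Defs
begin

text \<open>
  If \<open>\<xi>\<close>, \<open>\<zeta>\<close> and \<open>I \<xi>\<close>, \<open>\<zeta>'\<close> are associated, expanding \<open>T\<^sub>j = [X\<^sub>j, Y\<^sub>j]\<close> by the Jacobi identity gives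
  \<open>[T\<^sub>j, \<zeta>] = 2 \<lambda>(X\<^sub>j) \<lambda>\<^sub>I(X\<^sub>j) \<zeta>'\<close>, and the formula follows by comparing with \<open>\<rho>\<^sub>k\<close> for each type of
  root. This needs that every positive root lies in \<open>(BC)\<^sub>r\<^sup>+\<close>, and the second claim needs that
  \<open>\<lambda> = \<i> \<epsilon>\<^sub>l\<close> forces \<open>[T\<^sub>l, k\<^sub>\<lambda>] = 0\<close>. Both come from one identity: \<open>ad Z\<^sub>0\<close> satisfies \<open>u\<^sup>3 = - u\<close>, and
  this is inherited by \<open>Z\<^sub>0 - \<Sum> T\<^sub>j + \<Sum> \<plusminus>X\<^sub>j\<close> (a Cayley transform), since \<open>Z\<^sub>0 - T\<^sub>j\<close> commutes with
  \<open>X\<^sub>j, Y\<^sub>j, T\<^sub>j\<close>, so that \<open>T\<^sub>j\<close> may be rotated to \<open>\<plusminus>X\<^sub>j\<close>. The summands commute; hence, on a joint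
  eigenvector in a root space, \<open>z + \<Sum> \<plusminus>\<lambda>(X\<^sub>j) \<in> {0, \<i>, -\<i>}\<close> for all choices of signs, which leaves
  only the values of \<open>(BC)\<^sub>r\<close>.
\<close>

section \<open>Elements whose adjoint action satisfies \<open>u\<^sup>3 = - u\<close>\<close>

lemma scaleR_three: "3 *\<^sub>R w = w + w + w" for w :: "'a::real_vector"
  using scaleR_left_distrib[of 1 1 w] scaleR_left_distrib[of 2 1 w] by simp

lemma scaleR_three_eq_self: "3 *\<^sub>R w = w \<Longrightarrow> w = 0" for w :: "'a::real_vector"
  using scaleR_left_diff_distrib[of 3 1 w] by simp

context lie_algebra
begin

lemma bracket_add_left: "bracket (x + y) z = bracket x z + bracket y z"
  and bracket_add_right: "bracket x (y + z) = bracket x y + bracket x z"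
  and bracket_scale_left: "bracket (c *\<^sub>R x) y = c *\<^sub>R bracket x y"
  and bracket_scale_right: "bracket x (c *\<^sub>R y) = c *\<^sub>R bracket x y"
  and bracket_minus_left: "bracket (- x) y = - bracket x y"
  and bracket_minus_right: "bracket x (- y) = - bracket x y"
  and bracket_diff_left: "bracket (x - y) z = bracket x z - bracket y z"
  and bracket_diff_right: "bracket x (y - z) = bracket x y - bracket x z"
  and bracket_0_left: "bracket 0 y = 0"
  and bracket_0_right: "bracket x 0 = 0"
  using bilinear_bracket
  by (simp_all add: bilinear_ladd bilinear_radd bilinear_lmul bilinear_rmul bilinear_lneg
      bilinear_rneg bilinear_lsub bilinear_rsub bilinear_lzero bilinear_rzero)

lemmas bracket_simps = bracket_add_left bracket_add_right bracket_scale_left bracket_scale_right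
  bracket_minus_left bracket_minus_right bracket_diff_left bracket_diff_right
  bracket_0_left bracket_0_right

lemma bracket_sum_left: "bracket (\<Sum>i\<in>A. f i) y = (\<Sum>i\<in>A. bracket (f i) y)"
  by (induction A rule: infinite_finite_induct) (simp_all add: bracket_simps)

lemma bracket_commute: "bracket x y = - bracket y x"
proof -
  have "bracket x y + bracket y x = 0"
    using bracket_self[of "x + y"] unfolding bracket_add_left bracket_add_right
    by (simp add: bracket_self add.commute)
  then show ?thesis by (simp add: eq_neg_iff_add_eq_0)
qed

lemma bracket_derivation: "bracket x (bracket y z) = bracket (bracket x y) z + bracket y (bracket x z)"
  using jacobi[of x y z] bracket_commute[of z x] bracket_commute[of z "bracket x y"]
  by (simp add: bracket_simps) (metis add.commute add_diff_cancel_left' diff_add_cancel diff_minus_eq_add)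

lemma bracket_swap:
  assumes "bracket x y = 0"
  shows "bracket x (bracket y z) = bracket y (bracket x z)"
  using bracket_derivation[of x y z] assms by (simp add: bracket_simps)

text \<open>Over the complex numbers this means that \<open>ad u\<close> is diagonalizable with
  eigenvalues in {0, \<i>, -\<i>}; the polynomial form stays inside the real algebra.\<close>

definition cubic :: "'g \<Rightarrow> bool" where
  "cubic u \<longleftrightarrow> (\<forall>v. bracket u (bracket u (bracket u v)) = - bracket u v)"

text \<open>By \<open>xy\<close> and \<open>yt\<close>, \<open>ad y\<close> rotates \<open>t\<close>
  towards \<open>x\<close>. So the automorphism \<open>exp (\<pi>/2 ad y)\<close> fixes
  \<open>d\<close>, sends \<open>t\<close> to \<open>x\<close> and conjugates the two adjoint
  actions. The proof replaces this exponential by a polynomial in the derivation that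
  \<open>ad y\<close> induces on operators.\<close>

lemma cubic_rotate:
  assumes cub: "cubic (d + t)"
    and xy: "bracket x y = t" and yt: "bracket y t = x"
    and dx: "bracket d x = 0" and dy: "bracket d y = 0" and dt: "bracket d t = 0"
  shows "cubic (d + x)"
proof -
  define D where "D = bracket d"
  define S where "S = bracket t"
  define R where "R = bracket x"
  define Y where "Y = bracket y"
  note defs = D_def S_def R_def Y_def
  have add: "D (v + w) = D v + D w" "S (v + w) = S v + S w" "R (v + w) = R v + R w"
    "Y (v + w) = Y v + Y w" for v w
    by (simp_all add: defs bracket_simps)
  have scale: "D (c *\<^sub>R v) = c *\<^sub>R D v" "S (c *\<^sub>R v) = c *\<^sub>R S v" "R (c *\<^sub>R v) = c *\<^sub>R R v"
    "Y (c *\<^sub>R v) = c *\<^sub>R Y v" for c v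
    by (simp_all add: defs bracket_simps)
  have minus: "D (- v) = - D v" "S (- v) = - S v" "R (- v) = - R v" "Y (- v) = - Y v" for v
    by (simp_all add: defs bracket_simps)
  have diff: "D (v - w) = D v - D w" "S (v - w) = S v - S w" "R (v - w) = R v - R w"
    "Y (v - w) = Y v - Y w" for v w
    by (simp_all add: defs bracket_simps)
  have comm: "S (D v) = D (S v)" "R (D v) = D (R v)" "Y (D v) = D (Y v)" for v
    using bracket_swap[OF dx] bracket_swap[OF dy] bracket_swap[OF dt] by (simp_all add: defs)
  have yx: "bracket y x = - t" using bracket_commute xy by metis
  have YS: "Y (S v) = R v + S (Y v)" for v
    using bracket_derivation[of y t v] yt by (simp add: defs)
  have YR: "Y (R v) = - S v + R (Y v)" for v
    using bracket_derivation[of y x v] yx by (simp add: defs bracket_simps)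
  \<comment> \<open>\<open>G 1 1 0 1 0 0 1 0 0 0\<close> and \<open>G 1 0 1 0 0 1 0 0 0 1\<close> are \<open>D'\<^sup>3 + D'\<close> for \<open>D'\<close> the adjoint action of
    \<open>d + t\<close> and of \<open>d + x\<close>. The family is stable under commutation with \<open>Y\<close>, which acts on it
    as a derivation \<open>\<delta>\<close> with eigenvalues among \<open>\<i> n\<close> for \<open>\<bar>n\<bar> \<le> 3\<close>.\<close>
  define G :: "real \<Rightarrow> real \<Rightarrow> real \<Rightarrow> real \<Rightarrow> real \<Rightarrow> real \<Rightarrow> real \<Rightarrow> real \<Rightarrow> real \<Rightarrow> real \<Rightarrow> 'g \<Rightarrow> 'g" where
    "G c0 c1 c2 c3 c4 c5 c6 c7 c8 c9 v = c0 *\<^sub>R (D (D (D v)) + D v)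
       + c1 *\<^sub>R (3 *\<^sub>R D (D (S v)) + S v) + c2 *\<^sub>R (3 *\<^sub>R D (D (R v)) + R v)
       + 3 *\<^sub>R D (c3 *\<^sub>R S (S v) + c4 *\<^sub>R (S (R v) + R (S v)) + c5 *\<^sub>R R (R v))
       + c6 *\<^sub>R S (S (S v)) + c7 *\<^sub>R (S (S (R v)) + S (R (S v)) + R (S (S v)))
       + c8 *\<^sub>R (S (R (R v)) + R (S (R v)) + R (R (S v))) + c9 *\<^sub>R R (R (R v))"
    for c0 c1 c2 c3 c4 c5 c6 c7 c8 c9 v
  have multiples: "(c * 2) *\<^sub>R w = c *\<^sub>R w + c *\<^sub>R w" "(c * 3) *\<^sub>R w = c *\<^sub>R w + c *\<^sub>R w + c *\<^sub>R w"
    "(c * 6) *\<^sub>R w = (c * 3) *\<^sub>R w + (c * 3) *\<^sub>R w" for c :: real and w :: 'g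
    by (simp_all flip: scaleR_add_left)
  \<comment> \<open>\<open>\<delta>\<close> sends \<open>S\<close> to \<open>R\<close> and
    \<open>R\<close> to \<open>-S\<close> and kills \<open>D\<close>; the new coefficients record
    its effect on the symmetrized monomials.\<close>
  have step: "G 0 (-c2) c1 (-(c4+c4)) (c3-c5) (c4+c4) (-(c7+c7+c7)) (c6-(c8+c8)) (c7+c7-c9) (c8+c8+c8) v
      = Y (G c0 c1 c2 c3 c4 c5 c6 c7 c8 c9 v) - G c0 c1 c2 c3 c4 c5 c6 c7 c8 c9 (Y v)"
    for c0 c1 c2 c3 c4 c5 c6 c7 c8 c9 v
    by (simp add: G_def scaleR_three add scale minus diff comm YS YR multiples algebra_simps)
  have Y0: "Y 0 = 0" by (simp add: defs bracket_simps)
  have nxt: "\<forall>v. G 0 (-c2) c1 (-(c4+c4)) (c3-c5) (c4+c4) (-(c7+c7+c7)) (c6-(c8+c8)) (c7+c7-c9) (c8+c8+c8) v = 0"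
    if "\<forall>v. G c0 c1 c2 c3 c4 c5 c6 c7 c8 c9 v = 0" for c0 c1 c2 c3 c4 c5 c6 c7 c8 c9
    using that step[of c2 c1 c4 c3 c5 c7 c6 c8 c9 _ c0] by (simp add: Y0)
  have h0: "\<forall>v. G 1 1 0 1 0 0 1 0 0 0 v = 0"
  proof
    fix v
    have "bracket (d + t) (bracket (d + t) (bracket (d + t) v)) + bracket (d + t) v = 0"
      using cub by (simp add: cubic_def)
    then show "G 1 1 0 1 0 0 1 0 0 0 v = 0"
      by (simp add: G_def scaleR_three bracket_add_left defs[symmetric] add comm algebra_simps)
  qed
  \<comment> \<open>\<open>h0\<close> to \<open>h6\<close> are the iterates of order 0 to 6 of
    \<open>\<delta>\<close> on the identity for \<open>d + t\<close>. Interpolation at seven points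
    takes a polynomial of degree up to 6.\<close>
  have h1: "\<forall>v. G 0 0 1 0 1 0 0 1 0 0 v = 0" using nxt[OF h0] by simp
  note h2 = nxt[OF h1, simplified]
  note h3 = nxt[OF h2, simplified]
  note h4 = nxt[OF h3, simplified]
  note h5 = nxt[OF h4, simplified]
  note h6 = nxt[OF h5, simplified]
  show ?thesis unfolding cubic_def
  proof
    fix v
    \<comment> \<open>The rotation \<open>exp (\<pi>/2 \<delta>)\<close> taking \<open>t\<close> to \<open>x\<close> is the polynomial in \<open>\<delta>\<close> that interpolates
      \<open>exp (\<pi>/2 \<i> n)\<close> at \<open>\<i> n\<close>, \<open>\<bar>n\<bar> \<le> 3\<close>; its coefficients appear here.\<close>
    have "G 1 0 1 0 0 1 0 0 0 1 v = G 1 1 0 1 0 0 1 0 0 0 v + (22/15) *\<^sub>R G 0 0 1 0 1 0 0 1 0 0 v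
        + (109/90) *\<^sub>R G 0 (-1) 0 (-2) 0 2 (-3) 0 2 0 v + (1/2) *\<^sub>R G 0 0 (-1) 0 (-4) 0 0 (-7) 0 6 v
        + (2/9) *\<^sub>R G 0 1 0 8 0 (-8) 21 0 (-20) 0 v + (1/30) *\<^sub>R G 0 0 1 0 16 0 0 61 0 (-60) v
        + (1/90) *\<^sub>R G 0 (-1) 0 (-32) 0 32 (-183) 0 182 0 v" (is "?l = ?r")
    \<comment> \<open>Taking coordinates turns the vector identity into real arithmetic.\<close>
    proof (rule euclidean_eqI)
      fix b :: 'g
      show "?l \<bullet> b = ?r \<bullet> b"
        by (simp add: G_def add scale minus diff inner_add_left inner_diff_left algebra_simps)
    qed
    also have "\<dots> = 0"
      using h0 h1 h2 h3 h4 h5 h6 by simp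
    finally show "bracket (d + x) (bracket (d + x) (bracket (d + x) v)) = - bracket (d + x) v"
      by (simp add: G_def scaleR_three bracket_add_left defs[symmetric] add comm algebra_simps eq_neg_iff_add_eq_0)
  qed
qed

text \<open>As \<open>d\<close> and \<open>x\<close> commute, both cubes expand binomially; half the
  sum and half the difference isolate the parts even and odd in \<open>x\<close>.\<close>

lemma cubic_pair:
  assumes plus: "cubic (d + x)" and minus: "cubic (d - x)" and dx: "bracket d x = 0"
  shows "bracket d (bracket d (bracket d v)) + 3 *\<^sub>R bracket d (bracket x (bracket x v)) = - bracket d v"
    and "3 *\<^sub>R bracket d (bracket d (bracket x v)) + bracket x (bracket x (bracket x v)) = - bracket x v"
proof -
  let ?D = "bracket d" and ?R = "bracket x"
  have comm: "?R (?D w) = ?D (?R w)" for w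
    using bracket_swap[OF dx] by simp
  have "bracket (d + x) (bracket (d + x) (bracket (d + x) v)) + bracket (d + x) v = 0"
       "bracket (d - x) (bracket (d - x) (bracket (d - x) v)) + bracket (d - x) v = 0"
    using plus minus by (simp_all add: cubic_def)
  then have p: "?D (?D (?D v)) + 3 *\<^sub>R ?D (?D (?R v)) + 3 *\<^sub>R ?D (?R (?R v)) + ?R (?R (?R v)) + ?D v + ?R v = 0"
    and m: "?D (?D (?D v)) - 3 *\<^sub>R ?D (?D (?R v)) + 3 *\<^sub>R ?D (?R (?R v)) - ?R (?R (?R v)) + ?D v - ?R v = 0"
    by (simp_all add: bracket_simps comm scaleR_three algebra_simps)
  show "?D (?D (?D v)) + 3 *\<^sub>R ?D (?R (?R v)) = - ?D v"
  proof (rule euclidean_eqI)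
    fix b :: 'g
    show "(?D (?D (?D v)) + 3 *\<^sub>R ?D (?R (?R v))) \<bullet> b = - ?D v \<bullet> b"
      using arg_cong[OF p, of "\<lambda>u. u \<bullet> b"] arg_cong[OF m, of "\<lambda>u. u \<bullet> b"]
      by (simp add: inner_add_left inner_diff_left)
  qed
  show "3 *\<^sub>R ?D (?D (?R v)) + ?R (?R (?R v)) = - ?R v"
  proof (rule euclidean_eqI)
    fix b :: 'g
    show "(3 *\<^sub>R ?D (?D (?R v)) + ?R (?R (?R v))) \<bullet> b = - ?R v \<bullet> b"
      using arg_cong[OF p, of "\<lambda>u. u \<bullet> b"] arg_cong[OF m, of "\<lambda>u. u \<bullet> b"]
      by (simp add: inner_add_left inner_diff_left)
  qed
qed

text \<open>Excludes a nilpotent part of \<open>ad x\<close> at the eigenvalue 0. For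
  \<open>u = [x, v]\<close> the odd identity gives \<open>3 D D u = - u\<close>, the even one
  \<open>D D D u = - D u\<close>; together they force \<open>D u = 0\<close>, hence
  \<open>u = 0\<close>.\<close>

lemma cubic_pair_kernel:
  assumes plus: "cubic (d + x)" and minus: "cubic (d - x)" and dx: "bracket d x = 0"
    and v: "bracket x (bracket x v) = 0"
  shows "bracket x v = 0"
proof -
  let ?u = "bracket x v"
  have sq: "3 *\<^sub>R bracket d (bracket d ?u) = - ?u"
    using cubic_pair(2)[OF plus minus dx, of v] v by (simp add: bracket_simps)
  have "bracket d (bracket d (bracket d ?u)) = - bracket d ?u"
    using cubic_pair(1)[OF plus minus dx, of ?u] v by (simp add: bracket_simps)
  moreover have "3 *\<^sub>R bracket d (bracket d (bracket d ?u)) = - bracket d ?u"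
    using arg_cong[OF sq, of "bracket d"] by (simp add: bracket_simps)
  ultimately have "bracket d ?u = 0" using scaleR_three_eq_self by auto
  then show ?thesis using sq by (simp add: bracket_simps)
qed

text \<open>In terms of eigenvalues: if z + \<i> and z - \<i> both lie in {0, \<i>, -\<i>}, then z =
  0.\<close>

lemma cubic_pair_unit:
  assumes plus: "cubic (d + x)" and minus: "cubic (d - x)" and dx: "bracket d x = 0"
    and v: "bracket x (bracket x v) = - v"
  shows "bracket d v = 0"
proof -
  have "bracket d (bracket d (bracket x v)) = 0"
    using cubic_pair(2)[OF plus minus dx, of v] v by (simp add: bracket_simps)
  then have "bracket x (bracket d (bracket d (bracket x v))) = 0" by (simp add: bracket_simps)
  then have "bracket d (bracket d (bracket x (bracket x v))) = 0"
    by (simp add: bracket_swap[OF dx])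
  then have "bracket d (bracket d v) = 0" by (simp add: v bracket_simps)
  then have "3 *\<^sub>R bracket d v = bracket d v"
    using cubic_pair(1)[OF plus minus dx, of v] v by (simp add: bracket_simps)
  then show ?thesis by (rule scaleR_three_eq_self)
qed

end

section \<open>The polydisc frame\<close>

context hermitian_symmetric_pair
begin

lemma bracket_Z0_k: "x \<in> k \<Longrightarrow> bracket Z0 x = 0"
  using Z0_center by (simp add: lie_center_def)

lemma Z0_in_k: "Z0 \<in> k"
  using Z0_center by (simp add: lie_center_def)

lemma cubic_Z0: "cubic Z0"
  unfolding cubic_def
proof
  fix v
  have "v \<in> {u + v |u v. u \<in> k \<and> v \<in> m}" using k_plus_m by simp
  then obtain x y where v: "v = x + y" "x \<in> k" "y \<in> m" by blast
  then show "bracket Z0 (bracket Z0 (bracket Z0 v)) = - bracket Z0 v"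
    using complex_structure[OF v(3)] by (simp add: bracket_simps bracket_Z0_k)
qed

text \<open>\<open>ad Z0\<close> is a derivation and kills \<open>[x, y]\<close>, which lies in
  \<open>k\<close>.\<close>

lemma bracket_I_left:
  assumes "x \<in> m" "y \<in> m"
  shows "bracket (bracket Z0 x) y = - bracket x (bracket Z0 y)"
  using bracket_derivation[of Z0 x y] bracket_Z0_k[OF bracket_m_m[OF assms]]
  by (simp add: eq_neg_iff_add_eq_0)

end

context hermitian_symmetric_pair_with_frame
begin

abbreviation Y :: "nat \<Rightarrow> 'g" where "Y j \<equiv> bracket Z0 (X j)"

abbreviation T :: "nat \<Rightarrow> 'g" where "T \<equiv> T_vec bracket Z0 X"

lemma X_in_a: "j \<in> {1..r} \<Longrightarrow> X j \<in> a"
  using span_X by (auto intro: span_base)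

lemma X_in_m: "j \<in> {1..r} \<Longrightarrow> X j \<in> m"
  using X_in_a maximal_abelian by (auto simp: maximal_abelian_in_def)

lemma Y_in_m: "j \<in> {1..r} \<Longrightarrow> Y j \<in> m"
  using bracket_k_m[OF Z0_in_k X_in_m] .

lemma T_in_k: "j \<in> {1..r} \<Longrightarrow> T j \<in> k"
  unfolding T_vec_def by (intro bracket_m_m X_in_m Y_in_m)

lemma bracket_X_X: "\<lbrakk>i \<in> {1..r}; j \<in> {1..r}\<rbrakk> \<Longrightarrow> bracket (X i) (X j) = 0"
  using X_in_a maximal_abelian by (auto simp: maximal_abelian_in_def abelian_on_def)

lemma bracket_X_T:
  assumes "i \<in> {1..r}" "j \<in> {1..r}" "i \<noteq> j"
  shows "bracket (X i) (T j) = 0"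
  using bracket_T_X[of j i] assms by (subst bracket_commute) simp

lemma bracket_T_T:
  assumes "i \<in> {1..r}" "j \<in> {1..r}"
  shows "bracket (T i) (T j) = 0"
proof (cases "i = j")
  case False
  have "bracket (T i) (bracket (X j) (Y j)) = 0"
    using bracket_T_X[of i j] bracket_T_Y[of i j] assms False
    by (subst bracket_derivation) (simp add: bracket_simps)
  then show ?thesis by (simp add: T_vec_def)
qed (simp add: bracket_self)

text \<open>Induction from \<open>cubic_Z0\<close>, rotating one index at a time. The triple used is
  \<open>s j *\<^sub>R X j\<close>, \<open>s j *\<^sub>R Y j\<close>, \<open>T j\<close>, whose
  relations hold for both signs because \<open>s j * s j = 1\<close>.\<close>

lemma cubic_frame:
  assumes "finite J" "J \<subseteq> {1..r}" "\<And>j. j \<in> J \<Longrightarrow> s j * s j = (1::real)"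
  shows "cubic (Z0 - (\<Sum>j\<in>J. T j) + (\<Sum>j\<in>J. s j *\<^sub>R X j))"
  using assms
proof (induction J rule: finite_induct)
  case empty
  then show ?case by (simp add: cubic_Z0)
next
  case (insert j J)
  have j: "j \<in> {1..r}" and J: "\<And>i. i \<in> J \<Longrightarrow> i \<in> {1..r} \<and> i \<noteq> j" and s: "s j * s j = 1"
    using insert by auto
  \<comment> \<open>Chosen so that \<open>d + T j\<close> is the element of the induction hypothesis
    and \<open>d + s j *\<^sub>R X j\<close> the new one.\<close>
  define d where "d = Z0 - (T j + (\<Sum>i\<in>J. T i)) + (\<Sum>i\<in>J. s i *\<^sub>R X i)"
  have "cubic (d + s j *\<^sub>R X j)"
  proof (rule cubic_rotate)
    show "cubic (d + T j)" using insert by (simp add: d_def algebra_simps)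
    show "bracket (s j *\<^sub>R X j) (s j *\<^sub>R Y j) = T j"
      using s by (simp add: bracket_simps T_vec_def)
    show "bracket (s j *\<^sub>R Y j) (T j) = s j *\<^sub>R X j"
      using bracket_T_Y[OF j j] by (subst bracket_commute) (simp add: bracket_simps)
    show "bracket d (s j *\<^sub>R X j) = 0"
      using J by (simp add: d_def bracket_simps bracket_sum_left bracket_T_X[OF j j]
          bracket_T_X[OF _ j] bracket_X_X[OF _ j])
    show "bracket d (s j *\<^sub>R Y j) = 0"
      using J by (simp add: d_def bracket_simps bracket_sum_left bracket_T_Y[OF j j]
          bracket_T_Y[OF _ j] bracket_X_Y[OF _ j] complex_structure[OF X_in_m[OF j]])
    show "bracket d (T j) = 0"
      using J by (simp add: d_def bracket_simps bracket_sum_left bracket_T_T[OF _ j] j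
          bracket_X_T[OF _ j] bracket_self bracket_Z0_k[OF T_in_k[OF j]])
  qed
  then show ?case using insert by (simp add: d_def algebra_simps)
qed

lemma cubic_frame_single:
  assumes j: "j \<in> {1..r}"
  shows "cubic (Z0 - T j + X j)" "cubic (Z0 - T j - X j)" "bracket (Z0 - T j) (X j) = 0"
  using cubic_frame[of "{j}" "\<lambda>_. 1"] cubic_frame[of "{j}" "\<lambda>_. -1"] j bracket_T_X[OF j j]
  by (simp_all add: bracket_simps)

lemma bracket_X_eq_0:
  assumes "j \<in> {1..r}" "bracket (X j) (bracket (X j) v) = 0"
  shows "bracket (X j) v = 0"
  by (rule cubic_pair_kernel[OF cubic_frame_single assms(2)]) (rule assms(1))+

text \<open>Serves the roots \<open>\<i> \<epsilon>\<^sub>l\<close>. If \<open>X j\<close> kills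
  \<open>\<zeta>\<close>, applying \<open>ad Z0\<close> shows that \<open>Y j\<close> kills it too,
  hence so does their bracket \<open>T j\<close>. In the other case \<open>cubic_pair_unit\<close>
  shows that \<open>Z0 - T j\<close> kills \<open>\<zeta>\<close>, as does
  \<open>Z0\<close>.\<close>

lemma bracket_T_k_eq_0:
  assumes j: "j \<in> {1..r}" and \<zeta>: "\<zeta> \<in> k"
    and sq: "bracket (X j) (bracket (X j) \<zeta>) = 0 \<or> bracket (X j) (bracket (X j) \<zeta>) = - \<zeta>"
  shows "bracket (T j) \<zeta> = 0"
  using sq
proof
  assume "bracket (X j) (bracket (X j) \<zeta>) = 0"
  then have X0: "bracket (X j) \<zeta> = 0" using bracket_X_eq_0 j by blast
  then have "bracket (Y j) \<zeta> = 0"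
    using bracket_derivation[of Z0 "X j" \<zeta>] bracket_Z0_k[OF \<zeta>] by (simp add: bracket_simps)
  then show ?thesis
    using bracket_derivation[of "X j" "Y j" \<zeta>] X0 by (simp add: T_vec_def bracket_simps)
next
  assume "bracket (X j) (bracket (X j) \<zeta>) = - \<zeta>"
  then have "bracket (Z0 - T j) \<zeta> = 0"
    using cubic_pair_unit[OF cubic_frame_single] j by blast
  then show ?thesis using bracket_Z0_k[OF \<zeta>] by (simp add: bracket_simps)
qed

text \<open>Expand \<open>T j\<close> as the bracket of \<open>X j\<close> and \<open>Y j\<close>.
  Moving \<open>Z0\<close> across the brackets reduces both resulting terms to
  \<open>[X j, I \<xi>]\<close>; they are equal, whence the factor 2.\<close>

lemma bracket_T_associated:
  assumes j: "j \<in> {1..r}" and \<zeta>: "\<zeta> \<in> k" and \<xi>: "\<xi> \<in> m"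
    and X\<xi>: "bracket (X j) \<xi> = c *\<^sub>R \<zeta>" and X\<zeta>: "bracket (X j) \<zeta> = - (c *\<^sub>R \<xi>)"
    and XI: "bracket (X j) (bracket Z0 \<xi>) = c' *\<^sub>R \<zeta>'"
  shows "bracket (T j) \<zeta> = (- 2 * c * c') *\<^sub>R \<zeta>'"
proof -
  have "bracket (Y j) \<zeta> = - (c *\<^sub>R bracket Z0 \<xi>)"
    using bracket_derivation[of Z0 "X j" \<zeta>] bracket_Z0_k[OF \<zeta>] X\<zeta> by (simp add: bracket_simps)
  moreover have "bracket (Y j) \<xi> = - (c' *\<^sub>R \<zeta>')"
    using bracket_I_left[OF X_in_m[OF j] \<xi>] XI by simp
  ultimately have "bracket (T j) \<zeta> = - (c *\<^sub>R c' *\<^sub>R \<zeta>') - c *\<^sub>R c' *\<^sub>R \<zeta>'"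
    using bracket_derivation[of "X j" "Y j" \<zeta>] X\<zeta> XI
    by (simp add: T_vec_def bracket_simps algebra_simps)
  then show ?thesis by (simp add: scaleR_2 flip: scaleR_scaleR)
qed

end

section \<open>Restricted roots\<close>

lemma cscale_simps:
  "c *\<^sub>c (u + v) = c *\<^sub>c u + c *\<^sub>c v" "(c + d) *\<^sub>c u = c *\<^sub>c u + d *\<^sub>c u"
  "c *\<^sub>c (u - v) = c *\<^sub>c u - c *\<^sub>c v" "(c - d) *\<^sub>c u = c *\<^sub>c u - d *\<^sub>c u"
  "c *\<^sub>c d *\<^sub>c u = (c * d) *\<^sub>c u" "(- c) *\<^sub>c u = - (c *\<^sub>c u)" "c *\<^sub>c (- u) = - (c *\<^sub>c u)"
  "0 *\<^sub>c u = 0" "1 *\<^sub>c u = u" "c *\<^sub>c 0 = 0"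
  by (auto simp: cscale_def prod_eq_iff algebra_simps)

lemma cscale_of_real: "of_real c *\<^sub>c u = c *\<^sub>R u"
  by (simp add: cscale_def prod_eq_iff)

lemma cscale_eq_0_iff: "c *\<^sub>c u = 0 \<longleftrightarrow> c = 0 \<or> u = 0"
proof
  assume cu: "c *\<^sub>c u = 0"
  show "c = 0 \<or> u = 0"
  proof (cases "c = 0")
    case False
    have "u = inverse c *\<^sub>c (c *\<^sub>c u)" using False by (simp add: cscale_simps)
    then show ?thesis by (simp add: cu cscale_simps)
  qed simp
qed (auto simp: cscale_simps)

lemma of_re_eq_cscaleD: "of_re u = c *\<^sub>c of_re v \<Longrightarrow> u = Re c *\<^sub>R v"
  by (simp add: of_re_def cscale_def)

text \<open>From the factorization \<open>E (E - \<i>) (E + \<i>) = 0\<close> on \<open>W\<close>: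
  one of \<open>v\<close>, \<open>E v\<close>, \<open>(E - \<i>) (E v)\<close> is an
  eigenvector.\<close>

lemma eigenvector_of_cubic:
  fixes E :: "'g::euclidean_space cplx \<Rightarrow> 'g cplx"
  assumes add: "\<And>u v. E (u + v) = E u + E v" and scale: "\<And>c u. E (c *\<^sub>c u) = c *\<^sub>c E u"
    and W_add: "\<And>u v. u \<in> W \<Longrightarrow> v \<in> W \<Longrightarrow> u + v \<in> W" and W_scale: "\<And>c u. u \<in> W \<Longrightarrow> c *\<^sub>c u \<in> W"
    and W_E: "\<And>u. u \<in> W \<Longrightarrow> E u \<in> W"
    and cubic: "\<And>u. u \<in> W \<Longrightarrow> E (E (E u)) = - E u"
    and v: "v \<in> W" "v \<noteq> 0"
  obtains u c where "u \<in> W" "u \<noteq> 0" "E u = c *\<^sub>c u"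
proof (cases "E v = 0")
  case True
  then show ?thesis using that[of v 0] v by (simp add: cscale_simps)
next
  case False
  define v1 where "v1 = E v"
  have v1: "v1 \<in> W" "v1 \<noteq> 0" "E (E v1) = - v1"
    using False v cubic W_E by (simp_all add: v1_def)
  show ?thesis
  proof (cases "E v1 = \<i> *\<^sub>c v1")
    case True
    then show ?thesis using that v1 by blast
  next
    case False
    define v2 where "v2 = E v1 + (- \<i>) *\<^sub>c v1"
    have "v2 \<in> W" using v1 by (simp add: v2_def W_add W_scale W_E)
    moreover have "v2 \<noteq> 0" using False by (simp add: v2_def cscale_simps)
    moreover have "E v2 = (- \<i>) *\<^sub>c v2"
      unfolding v2_def add scale by (simp add: v1 cscale_simps)
    ultimately show ?thesis by (rule that)
  qed
qed

text \<open>Flipping a single sign changes the total by \<open>2 * l j\<close>, a difference of two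
  elements of {0, \<i>, -\<i>}. Taking all signs along, then all against, the imaginary parts bounds
  \<open>Im z\<close> plus and minus the sum of moduli by 1 and -1.\<close>

lemma sign_combinations:
  fixes l :: "nat \<Rightarrow> complex"
  assumes fin: "finite J"
    and sgn: "\<And>s. (\<And>j. j \<in> J \<Longrightarrow> s j * s j = (1::real)) \<Longrightarrow>
      z + (\<Sum>j\<in>J. of_real (s j) * l j) \<in> {0, \<i>, - \<i>}"
  shows "j \<in> J \<Longrightarrow> Re (l j) = 0" and "j \<in> J \<Longrightarrow> Im (l j) \<in> {0, 1/2, -1/2, 1, -1}"
    and "(\<Sum>j\<in>J. \<bar>Im (l j)\<bar>) \<le> 1"
proof -
  have half: "2 * l j \<in> {0, \<i>, - \<i>, 2 * \<i>, - 2 * \<i>}" if j: "j \<in> J" for j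
  proof -
    define R where "R = (\<Sum>i\<in>J - {j}. l i)"
    have "(\<Sum>i\<in>J. of_real (if i = j then -1 else 1) * l i) = - l j + R"
      unfolding R_def by (subst sum.remove[OF fin j]) (auto intro!: sum.cong)
    moreover have "(\<Sum>i\<in>J. of_real 1 * l i) = l j + R"
      unfolding R_def by (subst sum.remove[OF fin j]) (auto intro!: sum.cong)
    ultimately have "z + (- l j + R) \<in> {0, \<i>, - \<i>}" "z + (l j + R) \<in> {0, \<i>, - \<i>}"
      using sgn[of "\<lambda>i. if i = j then -1 else 1"] sgn[of "\<lambda>_. 1"] by (simp_all split: if_splits)
    moreover have "u - w \<in> {0, \<i>, - \<i>, 2 * \<i>, - 2 * \<i>}"
      if "u \<in> {0, \<i>, - \<i>}" "w \<in> {0, \<i>, - \<i>}" for u w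
      using that by (elim insertE emptyE) simp_all
    ultimately have "(z + (l j + R)) - (z + (- l j + R)) \<in> {0, \<i>, - \<i>, 2 * \<i>, - 2 * \<i>}"
      by blast
    also have "(z + (l j + R)) - (z + (- l j + R)) = 2 * l j" by simp
    finally show ?thesis .
  qed
  show "Re (l j) = 0" if "j \<in> J" using half[OF that] by (auto simp: complex_eq_iff)
  show "Im (l j) \<in> {0, 1/2, -1/2, 1, -1}" if "j \<in> J"
    using half[OF that] by (auto simp: complex_eq_iff)
  define s where "s j = (if Im (l j) \<ge> 0 then 1 else -1 :: real)" for j
  have plus: "Im (z + (\<Sum>j\<in>J. of_real (s j) * l j)) = Im z + (\<Sum>j\<in>J. \<bar>Im (l j)\<bar>)"
    by (simp add: s_def) (auto intro!: sum.cong)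
  have minus: "Im (z + (\<Sum>j\<in>J. of_real (- s j) * l j)) = Im z - (\<Sum>j\<in>J. \<bar>Im (l j)\<bar>)"
    by (simp add: s_def flip: sum_negf) (auto intro!: sum.cong)
  have s_sq: "s j * s j = 1" "- s j * - s j = 1" for j by (simp_all add: s_def)
  have bound: "Im u \<le> 1 \<and> Im u \<ge> -1" if "u \<in> {0, \<i>, - \<i>}" for u
    using that by auto
  have "Im (z + (\<Sum>j\<in>J. of_real (s j) * l j)) \<le> 1"
    using bound[OF sgn[of s, OF s_sq(1)]] by blast
  moreover have "Im (z + (\<Sum>j\<in>J. of_real (- s j) * l j)) \<ge> -1"
    using bound[OF sgn[of "\<lambda>j. - s j", OF s_sq(2)]] by blast
  ultimately show "(\<Sum>j\<in>J. \<bar>Im (l j)\<bar>) \<le> 1"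
    unfolding plus minus by linarith
qed

text \<open>Nonzero entries have modulus at least 1/2 and the moduli add up to at most 1, so at most
  two entries survive, and two only if both have modulus 1/2. The first nonzero entry is the
  positive one at \<open>p\<close>.\<close>

lemma lex_positive_pattern:
  fixes \<mu> :: "nat \<Rightarrow> real"
  assumes vals: "\<And>j. j \<in> {1..r} \<Longrightarrow> \<mu> j \<in> {0, 1/2, -1/2, 1, -1}"
    and le: "(\<Sum>j\<in>{1..r}. \<bar>\<mu> j\<bar>) \<le> 1"
    and p: "p \<in> {1..r}" "\<And>l. l \<in> {1..<p} \<Longrightarrow> \<mu> l = 0" "\<mu> p > 0"
  obtains "\<And>j. j \<in> {1..r} \<Longrightarrow> \<mu> j = (if j = p then 1/2 else 0)"
  | "\<And>j. j \<in> {1..r} \<Longrightarrow> \<mu> j = (if j = p then 1 else 0)"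
  | q t where "q \<in> {1..r}" "p < q" "t = 1 \<or> t = -1"
      "\<And>j. j \<in> {1..r} \<Longrightarrow> \<mu> j = (if j = p then 1/2 else if j = q then t/2 else 0)"
proof -
  have le2: "\<bar>\<mu> p\<bar> + (\<Sum>j\<in>{1..r} - {p}. \<bar>\<mu> j\<bar>) \<le> 1"
    using le p(1) by (subst (asm) sum.remove[of _ p]) auto
  show ?thesis
  proof (cases "\<forall>j\<in>{1..r} - {p}. \<mu> j = 0")
    case True
    have "\<mu> p = 1/2 \<or> \<mu> p = 1" using vals[OF p(1)] p(3) by auto
    then show ?thesis using that(1,2) True by (elim disjE) auto
  next
    case False
    then obtain q where q: "q \<in> {1..r} - {p}" "\<mu> q \<noteq> 0" by blast
    have "\<bar>\<mu> p\<bar> + (\<bar>\<mu> q\<bar> + (\<Sum>j\<in>{1..r} - {p} - {q}. \<bar>\<mu> j\<bar>)) \<le> 1"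
      using le2 q(1) by (subst (asm) sum.remove[of _ q]) auto
    moreover have "\<bar>\<mu> p\<bar> \<ge> 1/2" "\<bar>\<mu> q\<bar> \<ge> 1/2"
      using vals[of p] vals[of q] p q by auto
    moreover have nn: "(\<Sum>j\<in>{1..r} - {p} - {q}. \<bar>\<mu> j\<bar>) \<ge> 0" by (simp add: sum_nonneg)
    ultimately have half: "\<bar>\<mu> p\<bar> = 1/2" "\<bar>\<mu> q\<bar> = 1/2" "(\<Sum>j\<in>{1..r} - {p} - {q}. \<bar>\<mu> j\<bar>) = 0"
      by linarith+
    then have rest: "\<mu> j = 0" if "j \<in> {1..r}" "j \<noteq> p" "j \<noteq> q" for j
      using that by (subst (asm) sum_nonneg_eq_0_iff) auto
    have p_half: "\<mu> p = 1/2" using half(1) p(3) by simp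
    have "p < q" using p(2)[of q] q by (cases "q < p") auto
    show ?thesis
    proof (rule that(3)[of q "2 * \<mu> q"])
      show "2 * \<mu> q = 1 \<or> 2 * \<mu> q = -1" using half(2) by linarith
      show "\<mu> j = (if j = p then 1/2 else if j = q then 2 * \<mu> q / 2 else 0)" if "j \<in> {1..r}" for j
        using that rest p_half by simp
    qed (use q \<open>p < q\<close> in auto)
  qed
qed

section \<open>Coordinates of complex functionals in a dual basis\<close>

lemma dual_vec_basis:
  assumes "inj_on B {1..r}" "independent (B ` {1..r})" "j \<in> {1..r}" "l \<in> {1..r}"
  shows "dual_vec r B j (of_re (B l)) = (if j = l then 1 else 0)"
proof -
  have "B j = B l \<longleftrightarrow> j = l" using assms by (auto dest: inj_onD)
  then show ?thesis
    using assms by (auto simp: dual_vec_def of_re_def span_base span_zero representation_basis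
        representation_zero complex_eq_iff)
qed

lemma span_eq_sum_representation:
  fixes B :: "nat \<Rightarrow> 'g::euclidean_space"
  assumes "inj_on B {1..r}" "independent (B ` {1..r})" "x \<in> span (B ` {1..r})"
  shows "x = (\<Sum>j\<in>{1..r}. representation (B ` {1..r}) x (B j) *\<^sub>R B j)"
proof -
  have "finite (B ` {1..r})" by simp
  from sum_representation_eq[OF assms(2,3) this order_refl] assms(1) show ?thesis
    by (simp add: sum.reindex)
qed

lemma cdual_scale: "\<lbrakk>\<phi> \<in> cdual V; u \<in> V \<times> V\<rbrakk> \<Longrightarrow> \<phi> (c *\<^sub>c u) = c * \<phi> u"
  unfolding cdual_def by blast

lemma cdual_expand:
  assumes inj: "inj_on B {1..r}" and indep: "independent (B ` {1..r})"
    and \<phi>: "\<phi> \<in> cdual (span (B ` {1..r}))"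
  shows "\<phi> v = (\<Sum>j\<in>{1..r}. \<phi> (of_re (B j)) * dual_vec r B j v)"
proof (cases "v \<in> span (B ` {1..r}) \<times> span (B ` {1..r})")
  case False
  then have "dual_vec r B j v = 0" for j by (simp only: dual_vec_def if_False)
  moreover have "\<phi> v = 0" using \<phi> False unfolding cdual_def by blast
  ultimately show ?thesis by simp
next
  case True
  let ?V = "span (B ` {1..r})"
  have mem: "of_re (B j) \<in> ?V \<times> ?V" if "j \<in> {1..r}" for j
    using that by (simp add: of_re_def span_base span_zero)
  have cmem: "c *\<^sub>c u \<in> ?V \<times> ?V" if "u \<in> ?V \<times> ?V" for c u
    using that by (cases u) (simp add: cscale_def span_add span_diff span_scale)
  have zmem: "0 \<in> ?V \<times> ?V" by (simp add: zero_prod_def span_zero)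
  note \<phi>_scale = cdual_scale[OF \<phi>]
  have \<phi>_add: "\<phi> (u + w) = \<phi> u + \<phi> w" if "u \<in> ?V \<times> ?V" "w \<in> ?V \<times> ?V" for u w
    using \<phi> that unfolding cdual_def by blast
  \<comment> \<open>\<open>\<phi>\<close> is additive only on \<open>?V \<times> ?V\<close>, so
    membership of the partial sums is carried along with their values.\<close>
  have sum_mem: "(\<Sum>j\<in>J. c j *\<^sub>c of_re (B j)) \<in> ?V \<times> ?V
      \<and> \<phi> (\<Sum>j\<in>J. c j *\<^sub>c of_re (B j)) = (\<Sum>j\<in>J. c j * \<phi> (of_re (B j)))"
    if "finite J" "J \<subseteq> {1..r}" for c J
    using that
  proof (induction J rule: finite_induct)
    case empty
    then show ?case using \<phi>_scale[OF zmem, of 0] zmem by (simp add: cscale_simps)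
  next
    case (insert j J)
    let ?u = "c j *\<^sub>c of_re (B j)" and ?w = "\<Sum>i\<in>J. c i *\<^sub>c of_re (B i)"
    have j: "j \<in> {1..r}" and J: "J \<subseteq> {1..r}" using insert.prems by auto
    note IH = insert.IH[OF J]
    have u: "?u \<in> ?V \<times> ?V" by (intro cmem mem j)
    have "?u + ?w \<in> ?V \<times> ?V"
      using u IH by (auto intro: span_add simp only: mem_Times_iff fst_add snd_add)
    moreover have "\<phi> (?u + ?w) = c j * \<phi> (of_re (B j)) + (\<Sum>i\<in>J. c i * \<phi> (of_re (B i)))"
      using \<phi>_add[OF u conjunct1[OF IH]] \<phi>_scale[OF mem[OF j], of "c j"] conjunct2[OF IH]
      by (simp only:)
    ultimately show ?case unfolding sum.insert[OF insert.hyps] by (rule conjI)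
  qed
  obtain x y where v: "v = (x, y)" "x \<in> ?V" "y \<in> ?V" using True by auto
  have coeff: "dual_vec r B j v = Complex (representation (B ` {1..r}) x (B j))
      (representation (B ` {1..r}) y (B j))" for j
    using v(2,3) unfolding v(1) dual_vec_def by simp
  have "v = (\<Sum>j\<in>{1..r}. dual_vec r B j v *\<^sub>c of_re (B j))"
    unfolding coeff unfolding v(1)
    using span_eq_sum_representation[OF inj indep v(2), symmetric]
      span_eq_sum_representation[OF inj indep v(3), symmetric]
    by (simp add: prod_eq_iff fst_sum snd_sum cscale_def of_re_def)
  then have "\<phi> v = \<phi> (\<Sum>j\<in>{1..r}. dual_vec r B j v *\<^sub>c of_re (B j))" by (rule arg_cong)
  also have "\<dots> = (\<Sum>j\<in>{1..r}. dual_vec r B j v * \<phi> (of_re (B j)))"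
    using sum_mem[of "{1..r}" "\<lambda>j. dual_vec r B j v"] by simp
  finally show ?thesis by (simp add: mult.commute)
qed


section \<open>Positive restricted roots lie in \<open>(BC)\<^sub>r\<^sup>+\<close>\<close>

context hermitian_symmetric_pair_with_frame
begin

lemma cbracket_of_re: "cbracket bracket (of_re u) v = (bracket u (fst v), bracket u (snd v))"
  by (simp add: cbracket_def of_re_def bracket_simps)

text \<open>\<open>z\<close> is an eigenvalue of \<open>ad (Z0 - \<Sum> T j)\<close> on the joint
  eigenspace \<open>W\<close> of the \<open>ad (X j)\<close>. On its eigenvector all elements of
  \<open>cubic_frame\<close> act by scalars, which must be roots of
  \<open>c\<^sup>3 = - c\<close>.\<close>

lemma root_sign_sums:
  assumes lam: "lam \<in> restricted_roots bracket a"
  obtains z where "\<And>s. (\<And>j. j \<in> {1..r} \<Longrightarrow> s j * s j = (1::real)) \<Longrightarrow>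
      z + (\<Sum>j\<in>{1..r}. of_real (s j) * lam (of_re (X j))) \<in> {0, \<i>, - \<i>}"
proof -
  define A where "A u v = (bracket u (fst v), bracket u (snd v))" for u v
  define D where "D = Z0 - (\<Sum>j\<in>{1..r}. T j)"
  define W where "W = {v. \<forall>j\<in>{1..r}. A (X j) v = lam (of_re (X j)) *\<^sub>c v}"
  have A_add: "A u (v + w) = A u v + A u w" and A_scale: "A u (c *\<^sub>c v) = c *\<^sub>c A u v"
    and A_left: "A (u + u') v = A u v + A u' v" for u u' v w c
    by (simp_all add: A_def cscale_def bracket_simps)
  have A_sum: "A (\<Sum>j\<in>J. s j *\<^sub>R X j) v = (\<Sum>j\<in>J. of_real (s j) *\<^sub>c A (X j) v)" for J s v
    by (simp add: A_def prod_eq_iff fst_sum snd_sum bracket_sum_left bracket_simps cscale_of_real)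
  obtain v where "v \<noteq> 0" and v: "\<And>w. w \<in> a \<times> a \<Longrightarrow> cbracket bracket w v = lam w *\<^sub>c v"
    using lam unfolding restricted_roots_def by blast
  have "0 \<in> a" using maximal_abelian by (auto simp: maximal_abelian_in_def subspace_0)
  then have "A (X j) v = lam (of_re (X j)) *\<^sub>c v" if "j \<in> {1..r}" for j
    using v[of "of_re (X j)"] X_in_a[OF that] by (simp add: cbracket_of_re A_def) (simp add: of_re_def)
  then have vW: "v \<in> W" by (simp add: W_def)
  \<comment> \<open>\<open>Z0\<close> and \<open>T j\<close> both send \<open>X j\<close> to
    \<open>Y j\<close>, and the other \<open>T i\<close> kill it; so \<open>ad D\<close> preserves
    \<open>W\<close>.\<close>
  have DX: "bracket (X j) D = 0" if j: "j \<in> {1..r}" for j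
  proof -
    have "(\<Sum>i\<in>{1..r}. bracket (T i) (X j)) = (\<Sum>i\<in>{1..r}. if i = j then Y j else 0)"
      by (intro sum.cong refl) (use bracket_T_X j in auto)
    then have "bracket D (X j) = 0"
      using j by (simp add: D_def bracket_simps bracket_sum_left)
    then show ?thesis by (subst bracket_commute) simp
  qed
  have W_add: "u + w \<in> W" if "u \<in> W" "w \<in> W" for u w
    using that by (simp add: W_def A_add cscale_simps)
  have W_scale: "c *\<^sub>c u \<in> W" if "u \<in> W" for u c
    using that by (simp add: W_def A_scale cscale_simps mult.commute)
  have W_D: "A D u \<in> W" if "u \<in> W" for u
  proof -
    have "A (X j) (A D u) = A D (A (X j) u)" if "j \<in> {1..r}" for j
      using bracket_swap[OF DX[OF that]] by (simp add: A_def)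
    then show ?thesis using that by (simp add: W_def A_scale)
  qed
  define \<sigma> where "\<sigma> s = (\<Sum>j\<in>{1..r}. of_real (s j) * lam (of_re (X j)))" for s :: "nat \<Rightarrow> real"
  \<comment> \<open>On \<open>W\<close>, \<open>E s\<close> differs from \<open>ad D\<close> by the scalar \<open>\<sigma> s\<close>, so one eigenvector of \<open>E 1\<close> serves for all signs.\<close>
  define E where "E s = A (D + (\<Sum>j\<in>{1..r}. s j *\<^sub>R X j))" for s :: "nat \<Rightarrow> real"
  have cscale_sum: "(\<Sum>j\<in>J. f j) *\<^sub>c u = (\<Sum>j\<in>J. f j *\<^sub>c u)" for f :: "nat \<Rightarrow> complex" and J and u :: "'g cplx"
    by (induction J rule: infinite_finite_induct) (simp_all add: cscale_simps)
  have E_W: "E s u = A D u + \<sigma> s *\<^sub>c u" if "u \<in> W" for s u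
    using that by (simp add: E_def A_left A_sum W_def \<sigma>_def cscale_sum cscale_simps)
  have E_cubic: "E s (E s (E s u)) = - E s u" if "\<And>j. j \<in> {1..r} \<Longrightarrow> s j * s j = 1" for s u
    using cubic_frame[of "{1..r}" s] that by (simp add: E_def A_def D_def cubic_def)
  obtain u c where u: "u \<in> W" "u \<noteq> 0" "E (\<lambda>_. 1) u = c *\<^sub>c u"
  proof (rule eigenvector_of_cubic[of "E (\<lambda>_. 1)" W v])
    show "E (\<lambda>_. 1) (E (\<lambda>_. 1) (E (\<lambda>_. 1) u)) = - E (\<lambda>_. 1) u" for u
      by (rule E_cubic) simp
    show "E (\<lambda>_. 1) u \<in> W" if "u \<in> W" for u
      using that by (simp add: E_W W_add W_scale W_D)
  qed (use vW \<open>v \<noteq> 0\<close> W_add W_scale in \<open>auto simp: E_def A_add A_scale\<close>)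
  define z where "z = c - \<sigma> (\<lambda>_. 1)"
  have Du: "A D u = z *\<^sub>c u"
    using u E_W[OF u(1), of "\<lambda>_. 1"] by (simp add: z_def cscale_simps algebra_simps)
  show ?thesis
  proof (rule that[of z])
    fix s :: "nat \<Rightarrow> real" assume s: "\<And>j. j \<in> {1..r} \<Longrightarrow> s j * s j = 1"
    define c where "c = z + \<sigma> s"
    have Eu: "E s u = c *\<^sub>c u"
      using E_W[OF u(1)] Du by (simp add: c_def cscale_simps)
    have E_scale: "E s (b *\<^sub>c w) = b *\<^sub>c E s w" for b w by (simp add: E_def A_scale)
    have "(c * (c * c)) *\<^sub>c u = (- c) *\<^sub>c u"
      using E_cubic[of s u, OF s] by (simp add: Eu E_scale cscale_simps mult.assoc)
    then have "(c * (c * c) + c) *\<^sub>c u = 0" by (simp add: cscale_simps)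
    then have "c * ((c - \<i>) * (c + \<i>)) = 0"
      using u(2) by (simp add: cscale_eq_0_iff algebra_simps)
    then have "c \<in> {0, \<i>, - \<i>}" by (auto simp: eq_neg_iff_add_eq_0)
    then show "z + (\<Sum>j\<in>{1..r}. of_real (s j) * lam (of_re (X j))) \<in> {0, \<i>, - \<i>}"
      by (simp add: c_def \<sigma>_def)
  qed
qed

text \<open>Sign sums make \<open>lam (X j) = \<i> \<mu> j\<close> with \<open>\<mu>\<close> real
  and restricted to few values; lexicographic positivity then leaves the patterns of
  \<open>lex_positive_pattern\<close>, and the dual basis turns values back into
  functionals.\<close>

lemma positive_root_cases:
  assumes lam: "lam \<in> positive_restricted_roots bracket a r X"
  obtains p where "p \<in> {1..r}" "lam = (\<lambda>w. \<i> / 2 * dual_vec r X p w)"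
  | p where "p \<in> {1..r}" "lam = (\<lambda>w. \<i> * dual_vec r X p w)"
  | p q where "p \<in> {1..r}" "q \<in> {1..r}" "p < q"
      "lam = (\<lambda>w. \<i> / 2 * (dual_vec r X p w + dual_vec r X q w))"
  | p q where "p \<in> {1..r}" "q \<in> {1..r}" "p < q"
      "lam = (\<lambda>w. \<i> / 2 * (dual_vec r X p w - dual_vec r X q w))"
proof -
  have root: "lam \<in> restricted_roots bracket a" and pos: "lex_positive r X lam"
    using lam by (simp_all add: positive_restricted_roots_def)
  obtain z where z: "\<And>s. (\<And>j. j \<in> {1..r} \<Longrightarrow> s j * s j = (1::real)) \<Longrightarrow>
      z + (\<Sum>j\<in>{1..r}. of_real (s j) * lam (of_re (X j))) \<in> {0, \<i>, - \<i>}"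
    using root_sign_sums[OF root] by blast
  define \<mu> where "\<mu> j = Im (lam (of_re (X j)))" for j
  note sgn = sign_combinations[of "{1..r}" z "\<lambda>j. lam (of_re (X j))", OF finite_atLeastAtMost z]
  have lam_X: "lam (of_re (X j)) = \<i> * of_real (\<mu> j)" if "j \<in> {1..r}" for j
    using sgn(1)[OF _ that] by (simp add: complex_eq_iff \<mu>_def)
  have cdual: "lam \<in> cdual (span (X ` {1..r}))"
    using root unfolding restricted_roots_def span_X by blast
  have expand: "lam v = (\<Sum>j\<in>{1..r}. \<i> * of_real (\<mu> j) * dual_vec r X j v)" for v
    unfolding cdual_expand[OF inj_X independent_X cdual, of v]
    by (intro sum.cong refl) (simp only: lam_X)
  \<comment> \<open>The order is tested on \<open>- \<i> X j\<close>, where the root takes the real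
    value \<open>\<mu> j\<close>.\<close>
  have lam_iX: "lam ((- \<i>) *\<^sub>c of_re (X j)) = of_real (\<mu> j)" if j: "j \<in> {1..r}" for j
  proof -
    have "of_re (X j) \<in> span (X ` {1..r}) \<times> span (X ` {1..r})"
      using j by (simp add: of_re_def span_base span_zero)
    then have "lam ((- \<i>) *\<^sub>c of_re (X j)) = (- \<i>) * lam (of_re (X j))"
      by (rule cdual_scale[OF cdual])
    then show ?thesis using lam_X[OF j] by simp
  qed
  obtain p where p: "p \<in> {1..r}" "\<And>l. l \<in> {1..<p} \<Longrightarrow> \<mu> l = 0" "\<mu> p > 0"
  proof -
    obtain p where "p \<in> {1..r}" "\<forall>l\<in>{1..<p}. lam ((- \<i>) *\<^sub>c of_re (X l)) = 0"
      "Re (lam ((- \<i>) *\<^sub>c of_re (X p))) > 0"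
      using pos unfolding lex_positive_def by blast
    then show ?thesis using that[of p] by (simp add: lam_iX)
  qed
  have vals: "\<mu> j \<in> {0, 1/2, -1/2, 1, -1}" if "j \<in> {1..r}" for j
    using sgn(2)[OF _ that] by (simp add: \<mu>_def)
  have le: "(\<Sum>j\<in>{1..r}. \<bar>\<mu> j\<bar>) \<le> 1"
    using sgn(3) by (simp add: \<mu>_def)
  show ?thesis
  proof (rule lex_positive_pattern[OF vals le p])
    assume \<mu>: "\<And>j. j \<in> {1..r} \<Longrightarrow> \<mu> j = (if j = p then 1/2 else 0)"
    have "lam v = \<i> / 2 * dual_vec r X p v" for v
    proof -
      have "lam v = (\<Sum>j\<in>{1..r}. if j = p then \<i> / 2 * dual_vec r X p v else 0)"
        unfolding expand by (intro sum.cong refl) (simp add: \<mu>)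
      then show ?thesis using p(1) by simp
    qed
    then show ?thesis using that(1) p(1) by blast
  next
    assume \<mu>: "\<And>j. j \<in> {1..r} \<Longrightarrow> \<mu> j = (if j = p then 1 else 0)"
    have "lam v = \<i> * dual_vec r X p v" for v
    proof -
      have "lam v = (\<Sum>j\<in>{1..r}. if j = p then \<i> * dual_vec r X p v else 0)"
        unfolding expand by (intro sum.cong refl) (simp add: \<mu>)
      then show ?thesis using p(1) by simp
    qed
    then show ?thesis using that(2) p(1) by blast
  next
    fix q and t :: real
    assume q: "q \<in> {1..r}" "p < q" and t: "t = 1 \<or> t = -1"
      and \<mu>: "\<And>j. j \<in> {1..r} \<Longrightarrow> \<mu> j = (if j = p then 1/2 else if j = q then t/2 else 0)"
    have comb: "lam v = \<i> / 2 * (dual_vec r X p v + of_real t * dual_vec r X q v)" for v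
    proof -
      have "lam v = (\<Sum>j\<in>{1..r}. (if j = p then \<i> / 2 * dual_vec r X p v else 0)
          + (if j = q then \<i> / 2 * of_real t * dual_vec r X q v else 0))"
        unfolding expand by (intro sum.cong refl) (use q in \<open>simp add: \<mu>\<close>)
      then show ?thesis using p(1) q(1) by (simp add: sum.distrib distrib_left)
    qed
    from t show ?thesis
    proof
      assume "t = 1"
      then have "lam = (\<lambda>w. \<i> / 2 * (dual_vec r X p w + dual_vec r X q w))"
        using comb by (simp add: fun_eq_iff)
      then show ?thesis using that(3) p(1) q by blast
    next
      assume "t = -1"
      then have "lam = (\<lambda>w. \<i> / 2 * (dual_vec r X p w - dual_vec r X q w))"
        using comb by (simp add: fun_eq_iff)
      then show ?thesis using that(4) p(1) q by blast
    qed
  qed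
qed

end

section \<open>Evaluation of \<open>\<lambda>\<^sub>I\<close> and \<open>\<rho>\<^sub>k\<close> on
  normal forms\<close>

context hermitian_symmetric_pair_with_frame
begin

abbreviation \<epsilon> :: "nat \<Rightarrow> 'g cplx \<Rightarrow> complex" where "\<epsilon> \<equiv> dual_vec r X"

abbreviation \<epsilon>' :: "nat \<Rightarrow> 'g cplx \<Rightarrow> complex" where "\<epsilon>' \<equiv> dual_vec r T"

lemmas dual_X = dual_vec_basis[OF inj_X independent_X]

text \<open>
  All of \<open>(BC)\<^sub>r\<^sup>+\<close> in one normal form: \<open>p < q\<close> with \<open>t = \<plusminus>1\<close> for the roots with two indices, and
  \<open>p = q\<close>, \<open>t = 0\<close> for \<open>\<i>/2 \<epsilon>\<^sub>p\<close> (\<open>s = 1\<close>) and \<open>\<i> \<epsilon>\<^sub>p\<close> (\<open>s = 2\<close>).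
\<close>

definition bc_functional :: "nat \<Rightarrow> nat \<Rightarrow> complex \<Rightarrow> complex \<Rightarrow> 'g cplx \<Rightarrow> complex" where
  "bc_functional p q s t = (\<lambda>w. \<i> / 2 * (s * \<epsilon> p w + t * \<epsilon> q w))"

lemma bc_functional_simps:
  "(\<lambda>w. \<i> / 2 * \<epsilon> p w) = bc_functional p p 1 0" "(\<lambda>w. \<i> * \<epsilon> p w) = bc_functional p p 2 0"
  "(\<lambda>w. \<i> / 2 * (\<epsilon> p w + \<epsilon> q w)) = bc_functional p q 1 1" "(\<lambda>w. \<i> / 2 * (\<epsilon> p w - \<epsilon> q w)) = bc_functional p q 1 (-1)"
  by (simp_all add: bc_functional_def fun_eq_iff)

lemma bc_functional_X:
  "\<lbrakk>p \<in> {1..r}; q \<in> {1..r}; j \<in> {1..r}\<rbrakk> \<Longrightarrow>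
    bc_functional p q s t (of_re (X j)) = \<i> / 2 * ((if p = j then s else 0) + (if q = j then t else 0))"
  by (simp add: bc_functional_def dual_X)

text \<open>Supplies the uniqueness behind the definite descriptions \<open>root_I\<close> and
  \<open>rho_k\<close>. Values at \<open>X\<close> for the four indices suffice: they reveal the
  support, and \<open>p < q\<close> tells the two indices apart.\<close>

lemma bc_functional_eq_iff:
  assumes p: "p \<in> {1..r}" "q \<in> {1..r}" "p' \<in> {1..r}" "q' \<in> {1..r}"
    and "p < q \<and> t \<noteq> 0 \<or> p = q \<and> t = 0" "p' < q' \<and> t' \<noteq> 0 \<or> p' = q' \<and> t' = 0" "s \<noteq> 0" "s' \<noteq> 0"
  shows "bc_functional p q s t = bc_functional p' q' s' t' \<longleftrightarrow> p = p' \<and> q = q' \<and> s = s' \<and> t = t'"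
proof
  assume eq: "bc_functional p q s t = bc_functional p' q' s' t'"
  have "(if p = j then s else 0) + (if q = j then t else 0) =
      (if p' = j then s' else 0) + (if q' = j then t' else 0)" if "j \<in> {1..r}" for j
    using fun_cong[OF eq, of "of_re (X j)"] that p by (simp add: bc_functional_X del: One_nat_def)
  note val = this[OF p(1)] this[OF p(2)] this[OF p(3)] this[OF p(4)]
  show "p = p' \<and> q = q' \<and> s = s' \<and> t = t'"
    using val assms(5-8) by (auto split: if_splits)
qed auto

lemma root_I_eq:
  assumes "p \<in> {1..r}" "q \<in> {1..r}"
  shows "root_I r X (bc_functional p p 1 0) = bc_functional p p 1 0"
    and "root_I r X (bc_functional p p 2 0) = (\<lambda>_. 0)"
    and "p < q \<Longrightarrow> root_I r X (bc_functional p q 1 1) = bc_functional p q 1 (-1)"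
    and "p < q \<Longrightarrow> root_I r X (bc_functional p q 1 (-1)) = bc_functional p q 1 1"
  unfolding root_I_def Let_def bc_functional_simps
  subgoal
    by (rule the_equality, rule disjI1, use assms in blast,
        use assms in \<open>auto simp: bc_functional_eq_iff simp del: One_nat_def\<close>)
  subgoal
    by (rule the_equality, rule disjI2, rule disjI1, use assms in blast,
        use assms in \<open>auto simp: bc_functional_eq_iff simp del: One_nat_def\<close>)
  subgoal
    by (rule the_equality, rule disjI2, rule disjI2, rule disjI1, use assms in blast,
        use assms in \<open>auto simp: bc_functional_eq_iff simp del: One_nat_def\<close>)
  subgoal
    by (rule the_equality, rule disjI2, rule disjI2, rule disjI2, use assms in blast,
        use assms in \<open>auto simp: bc_functional_eq_iff simp del: One_nat_def\<close>)
  done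

lemma rho_k_eq:
  assumes "p \<in> {1..r}" "q \<in> {1..r}"
  shows "rho_k r X T (bc_functional p p 1 0) = (\<lambda>w. \<i> / 2 * \<epsilon>' p w)"
    and "p < q \<Longrightarrow> rho_k r X T (bc_functional p q 1 1) = (\<lambda>w. \<i> / 2 * (\<epsilon>' p w - \<epsilon>' q w))"
    and "p < q \<Longrightarrow> rho_k r X T (bc_functional p q 1 (-1)) = (\<lambda>w. \<i> / 2 * (\<epsilon>' p w - \<epsilon>' q w))"
  unfolding rho_k_def Let_def bc_functional_simps
  subgoal
    by (rule the_equality, rule disjI1, use assms in blast,
        use assms in \<open>auto simp: bc_functional_eq_iff simp del: One_nat_def\<close>)
  subgoal
    by (rule the_equality, rule disjI2, rule disjI2, use assms in blast,
        use assms in \<open>auto simp: bc_functional_eq_iff simp del: One_nat_def\<close>)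
  subgoal
    by (rule the_equality, rule disjI2, rule disjI2, use assms in blast,
        use assms in \<open>auto simp: bc_functional_eq_iff simp del: One_nat_def\<close>)
  done

lemma bc_functional_neq_0:
  assumes "p \<in> {1..r}" "q \<in> {1..r}" "p < q \<or> p = q \<and> t = 0" "s \<noteq> 0"
  shows "bc_functional p q s t \<noteq> (\<lambda>_. 0)"
proof
  assume "bc_functional p q s t = (\<lambda>_. 0)"
  from fun_cong[OF this, of "of_re (X p)"] show False
    using assms by (auto simp: bc_functional_X split: if_splits simp del: One_nat_def)
qed

section \<open>The basis \<open>T j\<close> and the action of its span\<close>

lemma Y_neq_0:
  assumes "j \<in> {1..r}"
  shows "Y j \<noteq> 0"
proof
  assume "Y j = 0"
  then have "X j = 0" using complex_structure[OF X_in_m[OF assms]] by (simp add: bracket_simps)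
  then show False using independent_X assms dependent_zero by (metis imageI)
qed

text \<open>The \<open>T j\<close> are told apart by their action on \<open>X\<close>, since
  \<open>Y i\<close> is nonzero. With \<open>independent_T\<close> this makes
  \<open>\<epsilon>'\<close> a true dual basis.\<close>

lemma inj_T: "inj_on T {1..r}"
proof (rule inj_onI)
  fix i j assume ij: "i \<in> {1..r}" "j \<in> {1..r}" "T i = T j"
  then have "bracket (T j) (X i) = Y i" using bracket_T_X[OF ij(1) ij(1)] by simp
  then show "i = j" using bracket_T_X[OF ij(2) ij(1)] Y_neq_0[OF ij(1)] by (auto split: if_splits)
qed

text \<open>Bracketing a relation with \<open>X l\<close> leaves only the coefficient of
  \<open>T l\<close>, times \<open>Y l\<close>.\<close>

lemma independent_T: "independent (T ` {1..r})"
proof (rule independent_if_scalars_zero)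
  fix f x assume sum0: "(\<Sum>x\<in>T ` {1..r}. f x *\<^sub>R x) = 0" and "x \<in> T ` {1..r}"
  then obtain l where l: "l \<in> {1..r}" "x = T l" by auto
  have "0 = bracket (\<Sum>j\<in>{1..r}. f (T j) *\<^sub>R T j) (X l)"
    using sum0 unfolding sum.reindex[OF inj_T] by (simp add: bracket_simps)
  also have "\<dots> = (\<Sum>j\<in>{1..r}. if j = l then f (T l) *\<^sub>R Y l else 0)"
    unfolding bracket_sum_left bracket_scale_left
    by (intro sum.cong refl) (use l(1) bracket_T_X in auto)
  finally have "f (T l) *\<^sub>R Y l = 0" using l(1) by simp
  then show "f x = 0" using Y_neq_0[OF l(1)] l(2) by simp
qed simp

lemma bracket_T_span:
  assumes "S \<in> T_span bracket Z0 r X"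
  shows "bracket S v = (\<Sum>j\<in>{1..r}. Re (\<epsilon>' j (of_re S)) *\<^sub>R bracket (T j) v)"
    and "Im (\<epsilon>' j (of_re S)) = 0"
proof -
  have S: "S \<in> span (T ` {1..r})" using assms by (simp add: T_span_def)
  then have rep: "\<epsilon>' j (of_re S) = of_real (representation (T ` {1..r}) S (T j))" for j
    by (simp add: dual_vec_def of_re_def span_zero representation_zero complex_eq_iff del: One_nat_def)
  then show "Im (\<epsilon>' j (of_re S)) = 0" by simp
  have "bracket S v = bracket (\<Sum>j\<in>{1..r}. representation (T ` {1..r}) S (T j) *\<^sub>R T j) v"
    by (rule arg_cong[OF span_eq_sum_representation[OF inj_T independent_T S], of "\<lambda>u. bracket u v"])
  then show "bracket S v = (\<Sum>j\<in>{1..r}. Re (\<epsilon>' j (of_re S)) *\<^sub>R bracket (T j) v)"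
    by (simp add: rep bracket_sum_left bracket_simps)
qed

lemma bracket_T_span_associated:
  assumes \<xi>: "\<xi> \<in> m" and \<zeta>: "associated bracket a k lam \<xi> \<zeta>"
    and \<zeta>': "associated bracket a k lam' (bracket Z0 \<xi>) \<zeta>'" and S: "S \<in> T_span bracket Z0 r X"
  shows "bracket S \<zeta> = (\<Sum>j\<in>{1..r}. Re (\<epsilon>' j (of_re S)) * (- 2 * Im (lam (of_re (X j))) * Im (lam' (of_re (X j))))) *\<^sub>R \<zeta>'"
proof -
  have k: "\<zeta> \<in> k" using \<zeta> by (simp add: associated_def root_space_def)
  have "bracket (T j) \<zeta> = (- 2 * Im (lam (of_re (X j))) * Im (lam' (of_re (X j)))) *\<^sub>R \<zeta>'"
    if j: "j \<in> {1..r}" for j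
  proof -
    \<comment> \<open>The vectors are real, so only the real part of the scalar
      \<open>\<i> * lam (X j)\<close> acts, namely \<open>- Im (lam (X j))\<close>.\<close>
    have "bracket (X j) \<xi> = - Im (lam (of_re (X j))) *\<^sub>R \<zeta>" "bracket (X j) \<zeta> = Im (lam (of_re (X j))) *\<^sub>R \<xi>"
      "bracket (X j) (bracket Z0 \<xi>) = - Im (lam' (of_re (X j))) *\<^sub>R \<zeta>'"
      using \<zeta> \<zeta>' X_in_a[OF j] by (auto simp: associated_def dest!: bspec of_re_eq_cscaleD)
    then show ?thesis
      using bracket_T_associated[OF j k \<xi>, of "- Im (lam (of_re (X j)))" "- Im (lam' (of_re (X j)))" \<zeta>']
      by simp
  qed
  then show ?thesis
    by (simp add: bracket_T_span(1)[OF S] scaleR_sum_left)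
qed

end

section \<open>Comparison with \<open>\<rho>\<^sub>k\<close> for each type of root\<close>

theorem corollary4p7p3:
  fixes bracket :: "'g::euclidean_space \<Rightarrow> 'g \<Rightarrow> 'g"
    and k m a :: "'g set" and Z0 :: 'g and r :: nat and X :: "nat \<Rightarrow> 'g"
    and lam :: "'g cplx \<Rightarrow> complex"
  assumes "hermitian_symmetric_pair_with_frame bracket k m Z0 a r X"
    and "lam \<in> positive_restricted_roots bracket a r X"
  shows "(root_I r X lam \<noteq> (\<lambda>_. 0) \<longrightarrow>
            (\<forall>\<xi> \<in> root_space bracket a m lam. \<forall>\<zeta> \<zeta>'.
               associated bracket a k lam \<xi> \<zeta> \<and>
               associated bracket a k (root_I r X lam) (bracket Z0 \<xi>) \<zeta>' \<longrightarrow>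
               (\<forall>T \<in> T_span bracket Z0 r X.
                  of_re (bracket T \<zeta>) =
                  (\<i> * rho_k r X (T_vec bracket Z0 X) lam (of_re T)) *\<^sub>c of_re \<zeta>')))
       \<and> (root_I r X lam = (\<lambda>_. 0) \<longrightarrow>
            (\<forall>T \<in> T_span bracket Z0 r X. \<forall>\<zeta> \<in> root_space bracket a k lam. bracket T \<zeta> = 0))"
proof -
  interpret hermitian_symmetric_pair_with_frame bracket k m Z0 a r X by fact
  define c where "c S = (\<Sum>j\<in>{1..r}. Re (\<epsilon>' j (of_re S)) *
      (- 2 * Im (lam (of_re (X j))) * Im (root_I r X lam (of_re (X j)))))" for S
  \<comment> \<open>Reduces the formula to the scalar identity \<open>rho\<close>, the only point
    that depends on the type of root.\<close>
  have main: "of_re (bracket S \<zeta>) = (\<i> * rho_k r X T lam (of_re S)) *\<^sub>c of_re \<zeta>'"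
    if "\<xi> \<in> root_space bracket a m lam" "associated bracket a k lam \<xi> \<zeta>"
      "associated bracket a k (root_I r X lam) (bracket Z0 \<xi>) \<zeta>'"
      and S: "S \<in> T_span bracket Z0 r X" and rho: "\<i> * rho_k r X T lam (of_re S) = of_real (c S)"
    for \<xi> \<zeta> \<zeta>' S
    unfolding rho cscale_of_real using bracket_T_span_associated[OF _ that(2,3) S] that(1)
    by (simp add: of_re_def root_space_def c_def)
  have two: ?thesis
    if pq: "p \<in> {1..r}" "q \<in> {1..r}" "p < q" and t: "t = 1 \<or> t = -1"
      and lam: "lam = bc_functional p q 1 t" for p q t
  proof -
    have I: "root_I r X lam = bc_functional p q 1 (- t)"
      and rho: "rho_k r X T lam = (\<lambda>w. \<i> / 2 * (\<epsilon>' p w - \<epsilon>' q w))"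
      using t pq by (auto simp: lam root_I_eq rho_k_eq simp del: One_nat_def)
    have "\<i> * rho_k r X T lam (of_re S) = of_real (c S)" if S: "S \<in> T_span bracket Z0 r X" for S
    proof -
      \<comment> \<open>The product of the imaginary parts of \<open>lam\<close> and
        \<open>\<lambda>\<^sub>I\<close> is 1/4 at \<open>p\<close> and
        \<open>- t\<^sup>2 / 4 = - 1/4\<close> at \<open>q\<close>; so both signs \<open>t\<close>
        give the same result, as \<open>\<rho>\<^sub>k\<close> demands.\<close>
      have "c S = (\<Sum>j\<in>{1..r}. (if j = p then - Re (\<epsilon>' p (of_re S)) / 2 else 0) +
          (if j = q then Re (\<epsilon>' q (of_re S)) / 2 else 0))"
        unfolding c_def I unfolding lam
        by (intro sum.cong refl) (use pq t in \<open>auto simp: bc_functional_X simp del: One_nat_def\<close>)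
      then show ?thesis
        using pq bracket_T_span(2)[OF S] by (simp add: rho complex_eq_iff sum.distrib)
    qed
    with main show ?thesis using pq t by (auto simp: I bc_functional_neq_0 simp del: One_nat_def)
  qed
  from assms(2) show ?thesis
  proof (cases rule: positive_root_cases)
    case (1 p)
    have lam: "lam = bc_functional p p 1 0" using 1(2) unfolding bc_functional_simps .
    have I: "root_I r X lam = bc_functional p p 1 0" using 1(1) by (simp add: lam root_I_eq)
    have "\<i> * rho_k r X T lam (of_re S) = of_real (c S)" if S: "S \<in> T_span bracket Z0 r X" for S
    proof -
      have "c S = (\<Sum>j\<in>{1..r}. if j = p then - Re (\<epsilon>' p (of_re S)) / 2 else 0)"
        unfolding c_def I unfolding lam
        by (intro sum.cong refl) (use 1(1) in \<open>auto simp: bc_functional_X simp del: One_nat_def\<close>)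
      then show ?thesis
        using 1(1) bracket_T_span(2)[OF S] by (simp add: lam rho_k_eq complex_eq_iff)
    qed
    with main show ?thesis using 1(1) by (auto simp: I bc_functional_neq_0 simp del: One_nat_def)
  next
    case (2 p)
    have lam: "lam = bc_functional p p 2 0" using 2(2) unfolding bc_functional_simps .
    have "bracket S \<zeta> = 0" if S: "S \<in> T_span bracket Z0 r X" and \<zeta>: "\<zeta> \<in> root_space bracket a k lam" for S \<zeta>
    proof -
      have k: "\<zeta> \<in> k" using \<zeta> by (simp add: root_space_def)
      have "bracket (T j) \<zeta> = 0" if j: "j \<in> {1..r}" for j
      \<comment> \<open>For \<open>\<i> \<epsilon>\<^sub>p\<close> the square of
        \<open>lam (X j)\<close> is -1 at \<open>j = p\<close> and 0 elsewhere, which are the two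
        admissible cases.\<close>
      proof (rule bracket_T_k_eq_0[OF j k])
        have "of_re (bracket (X j) (bracket (X j) \<zeta>)) = (lam (of_re (X j)))\<^sup>2 *\<^sub>c of_re \<zeta>"
          using \<zeta> X_in_a[OF j] by (simp add: root_space_def)
        from of_re_eq_cscaleD[OF this]
        show "bracket (X j) (bracket (X j) \<zeta>) = 0 \<or> bracket (X j) (bracket (X j) \<zeta>) = - \<zeta>"
          using 2(1) j by (cases "j = p") (auto simp: lam bc_functional_X simp del: One_nat_def)
      qed
      then show ?thesis by (simp add: bracket_T_span(1)[OF S])
    qed
    then show ?thesis using 2(1) by (simp add: lam root_I_eq)
  next
    case (3 p q)
    then show ?thesis using two[of p q 1] unfolding bc_functional_simps by simp
  next
    case (4 p q)
    then show ?thesis using two[of p q "-1"] unfolding bc_functional_simps by simp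
  qed
qed

end
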